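(* A fuzzy soft topological space $(X,\tau)$ is fuzzy soft $q$-$T_2$ if and only if for every fuzzy soft point $e_x^\alpha$ in $FS(X,E)$, $$e_x^\alpha=\sqcap\{\overline{f_A}: f_A \text{ is a fuzzy soft neighborhood of } e_x^\alpha\}.$$
   Context: $X$ is a nonempty universe and $E$ a set of parameters. $I^X$ is the set of functions $X\to[0,1]$ (fuzzy sets); $0_X,1_X$ are the constant functions. A fuzzy soft set over $X$ is a map $f_A:E\to I^X$, where $A\subseteq E$, $f_A(e)\ne 0_X$ if $e\in A$ and $f_A(e)=0_X$ if $e\notin A$; $FS(X,E)$ is the family of all of them. $\widetilde 0_E$ and $\widetilde 1_E$ are the fuzzy soft sets with value $0_X$, respectively $1_X$, at every $e\in E$. Write $f_A\sqsubseteq g_B$ if $f_A(e)\le g_B(e)$ pointwise for all $e\in E$; $\sqcup$ and $\sqcap$ are the pointwise supremum and infimum (also for arbitrary families); the complement is $f_A^c(e)=1-f_A(e)$. A fuzzy soft topological space $(X,\tau)$ consists of $X$ and a family $\tau\subseteq FS(X,E)$ containing $\widetilde 0_E,\widetilde 1_E$ and closed under binary $\sqcap$ and arbitrary $\sqcup$. Members of $\tau$ are called fuzzy soft open; $g_B$ is fuzzy soft closed if $g_B^c\in\tau$. The closure $\overline{f_A}$ is the smallest fuzzy soft closed set containing $f_A$. A fuzzy soft point $e_x^\alpha$ ($e\in E$, $x\in X$, $0<\alpha\le 1$) is the fuzzy soft set with value $\alpha$ at $(e,x)$ and $0$ at every other pair. $f_A\,q\,g_B$ (soft quasi-coincident)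 means that there are $e\in E$, $x\in X$ with $f_A(e)(x)+g_B(e)(x)>1$; $f_A\,\overline q\,g_B$ is the negation. $N(f_A)$ denotes the set of fuzzy soft neighborhoods of $f_A$: those $g_B$ for which some open $h_C$ satisfies $f_A\sqsubseteq h_C\sqsubseteq g_B$. $N_q(f_A)$ denotes the set of Q-neighborhoods of $f_A$: those $g_B$ for which some open $h_C$ satisfies $f_A\,q\,h_C$ and $h_C\sqsubseteq g_B$. $(X,\tau)$ is fuzzy soft $q$-$T_2$ if for all distinct fuzzy soft points $(e_1)_x^\alpha,(e_2)_y^\beta$: (a) when $e_1\neq e_2$ or $x\ne y$, there are fuzzy soft open sets $f_A\in N((e_1)_x^\alpha)$ and $g_B\in N((e_2)_y^\beta)$ with $f_A\,\overline q\,g_B$; (b) when $e_1=e_2$, $x=y$ and (say) $\alpha<\beta$, there are fuzzy soft open sets $f_A\in N((e_1)_x^\alpha)$ and $g_B\in N_q((e_2)_y^\beta)$ with $f_A\,\overline q\,g_B$. *)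

theory Defs
  imports Complex_Main
begin

text \<open>
  The universe \<open>X\<close> and the parameter set \<open>E\<close> are explicit carriers.  A fuzzy soft set is a
  function \<open>'e \<Rightarrow> 'x \<Rightarrow> real\<close> that is normalised to \<open>0\<close> outside \<open>E \<times> X\<close>, so that equality of
  functions is equality of fuzzy soft sets, and \<open>\<sqsubseteq>\<close>, binary \<open>\<sqinter>\<close> and the \<open>\<squnion>\<close>, \<open>\<sqinter>\<close> of nonempty
  families are the pointwise \<open>\<le>\<close>, \<open>inf\<close>, \<open>Sup\<close>, \<open>Inf\<close> on the function type.
\<close>

definition fuzzy_sets :: "'x set \<Rightarrow> ('x \<Rightarrow> real) set" where
  "fuzzy_sets X = {u. (\<forall>x\<in>X. 0 \<le> u x \<and> u x \<le> 1) \<and> (\<forall>x. x \<notin> X \<longrightarrow> u x = 0)}"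

definition is_fuzzy_soft_set ::
  "'x set \<Rightarrow> 'e set \<Rightarrow> 'e set \<Rightarrow> ('e \<Rightarrow> 'x \<Rightarrow> real) \<Rightarrow> bool" where
  "is_fuzzy_soft_set X E A f \<longleftrightarrow>
     A \<subseteq> E \<and> (\<forall>e\<in>A. f e \<in> fuzzy_sets X \<and> f e \<noteq> (\<lambda>x. 0)) \<and> (\<forall>e. e \<notin> A \<longrightarrow> f e = (\<lambda>x. 0))"

text \<open>The index \<open>A\<close> is determined by the function (it is its support), so it is not recorded.\<close>

definition FS :: "'x set \<Rightarrow> 'e set \<Rightarrow> ('e \<Rightarrow> 'x \<Rightarrow> real) set" where
  "FS X E = {f. \<exists>A. is_fuzzy_soft_set X E A f}"

definition fs_zero :: "'e \<Rightarrow> 'x \<Rightarrow> real" where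
  "fs_zero = (\<lambda>e x. 0)"

definition fs_one :: "'x set \<Rightarrow> 'e set \<Rightarrow> 'e \<Rightarrow> 'x \<Rightarrow> real" where
  "fs_one X E = (\<lambda>e x. if e \<in> E \<and> x \<in> X then 1 else 0)"

definition fs_compl :: "'x set \<Rightarrow> 'e set \<Rightarrow> ('e \<Rightarrow> 'x \<Rightarrow> real) \<Rightarrow> 'e \<Rightarrow> 'x \<Rightarrow> real" where
  "fs_compl X E f = (\<lambda>e x. if e \<in> E \<and> x \<in> X then 1 - f e x else 0)"

text \<open>
  The join of the empty family is \<open>fs_zero\<close>, which is required to be open separately;
  \<open>Sup {}\<close> on reals is unspecified.
\<close>

definition fuzzy_soft_topology :: "'x set \<Rightarrow> 'e set \<Rightarrow> ('e \<Rightarrow> 'x \<Rightarrow> real) set \<Rightarrow> bool" where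
  "fuzzy_soft_topology X E \<tau> \<longleftrightarrow>
     \<tau> \<subseteq> FS X E \<and> fs_zero \<in> \<tau> \<and> fs_one X E \<in> \<tau> \<and>
     (\<forall>f\<in>\<tau>. \<forall>g\<in>\<tau>. inf f g \<in> \<tau>) \<and>
     (\<forall>F. F \<subseteq> \<tau> \<and> F \<noteq> {} \<longrightarrow> Sup F \<in> \<tau>)"

definition fs_closed ::
  "'x set \<Rightarrow> 'e set \<Rightarrow> ('e \<Rightarrow> 'x \<Rightarrow> real) set \<Rightarrow> ('e \<Rightarrow> 'x \<Rightarrow> real) \<Rightarrow> bool" where
  "fs_closed X E \<tau> g \<longleftrightarrow> g \<in> FS X E \<and> fs_compl X E g \<in> \<tau>"

definition fs_closure ::
  "'x set \<Rightarrow> 'e set \<Rightarrow> ('e \<Rightarrow> 'x \<Rightarrow> real) set \<Rightarrow> ('e \<Rightarrow> 'x \<Rightarrow> real) \<Rightarrow> 'e \<Rightarrow> 'x \<Rightarrow> real" where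
  "fs_closure X E \<tau> f = (LEAST g. fs_closed X E \<tau> g \<and> f \<le> g)"

text \<open>A fuzzy soft point over \<open>X\<close>, \<open>E\<close> when \<open>e \<in> E\<close>, \<open>x \<in> X\<close> and \<open>0 < \<alpha> \<le> 1\<close>.\<close>

definition fs_point :: "'e \<Rightarrow> 'x \<Rightarrow> real \<Rightarrow> 'e \<Rightarrow> 'x \<Rightarrow> real" where
  "fs_point e x \<alpha> = (\<lambda>e' x'. if e' = e \<and> x' = x then \<alpha> else 0)"

definition quasi_coincident ::
  "'x set \<Rightarrow> 'e set \<Rightarrow> ('e \<Rightarrow> 'x \<Rightarrow> real) \<Rightarrow> ('e \<Rightarrow> 'x \<Rightarrow> real) \<Rightarrow> bool" where
  "quasi_coincident X E f g \<longleftrightarrow> (\<exists>e\<in>E. \<exists>x\<in>X. f e x + g e x > 1)"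

definition fs_nbhds ::
  "'x set \<Rightarrow> 'e set \<Rightarrow> ('e \<Rightarrow> 'x \<Rightarrow> real) set \<Rightarrow> ('e \<Rightarrow> 'x \<Rightarrow> real) \<Rightarrow> ('e \<Rightarrow> 'x \<Rightarrow> real) set" where
  "fs_nbhds X E \<tau> f = {g \<in> FS X E. \<exists>h\<in>\<tau>. f \<le> h \<and> h \<le> g}"

definition fs_Q_nbhds ::
  "'x set \<Rightarrow> 'e set \<Rightarrow> ('e \<Rightarrow> 'x \<Rightarrow> real) set \<Rightarrow> ('e \<Rightarrow> 'x \<Rightarrow> real) \<Rightarrow> ('e \<Rightarrow> 'x \<Rightarrow> real) set" where
  "fs_Q_nbhds X E \<tau> f = {g \<in> FS X E. \<exists>h\<in>\<tau>. quasi_coincident X E f h \<and> h \<le> g}"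

text \<open>The case \<open>\<beta> < \<alpha>\<close> of two points at the same place is covered by exchanging the two points.\<close>

definition fs_q_T2 :: "'x set \<Rightarrow> 'e set \<Rightarrow> ('e \<Rightarrow> 'x \<Rightarrow> real) set \<Rightarrow> bool" where
  "fs_q_T2 X E \<tau> \<longleftrightarrow>
     (\<forall>e1\<in>E. \<forall>e2\<in>E. \<forall>x\<in>X. \<forall>y\<in>X. \<forall>\<alpha>\<in>{0<..1}. \<forall>\<beta>\<in>{0<..1}.
        fs_point e1 x \<alpha> \<noteq> fs_point e2 y \<beta> \<longrightarrow>
          (e1 \<noteq> e2 \<or> x \<noteq> y \<longrightarrow>
             (\<exists>f\<in>\<tau>. \<exists>g\<in>\<tau>. f \<in> fs_nbhds X E \<tau> (fs_point e1 x \<alpha>) \<and>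
                 g \<in> fs_nbhds X E \<tau> (fs_point e2 y \<beta>) \<and> \<not> quasi_coincident X E f g)) \<and>
          (e1 = e2 \<and> x = y \<and> \<alpha> < \<beta> \<longrightarrow>
             (\<exists>f\<in>\<tau>. \<exists>g\<in>\<tau>. f \<in> fs_nbhds X E \<tau> (fs_point e1 x \<alpha>) \<and>
                 g \<in> fs_Q_nbhds X E \<tau> (fs_point e2 y \<beta>) \<and> \<not> quasi_coincident X E f g)))"

end

theory Submission
  imports Defs
begin

text \<open>
  Everything rests on one translation.  An open set \<open>g\<close> is not quasi-coincident with \<open>f\<close> exactly
  when \<open>f\<close> lies below the closed set \<open>fs_compl g\<close>, so the meet of the closures of the
  neighbourhoods of \<open>p\<close> is below \<open>c\<close> at \<open>(e, y)\<close> iff some open \<open>f \<ge> p\<close> and some open \<open>g\<close>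
  with \<open>g e y > 1 - c\<close> are not quasi-coincident (\<open>Inf_closures_less_iff\<close>).

  Read from right to left, this makes the separating sets of a \<open>q\<close>-\<open>T\<^sub>2\<close> space bound the meet of
  the closures by every level above that of the point.  Read from left to right, it turns the
  formula for the meet into separating sets: at the place of the point itself it yields the
  Q-neighbourhood directly, because that condition is a strict inequality.

  At a different place \<open>(d, y)\<close> a neighbourhood must reach its level, whereas a meet equal to
  \<open>0\<close> only produces open sets whose values at \<open>(d, y)\<close> approach \<open>1\<close>.  For
  two points of level \<open>1\<close> this is not enough, in whichever order they are taken.  But the formula
  holds at both points, so there are two sequences of separated pairs of open sets, one reaching
  level \<open>1\<close> at the first place and approaching it at the second, the other with the roles
  exchanged.  Interleaving them, as in the proof that regular Lindelof spaces are normal, gives one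
  separated pair that reaches level \<open>1\<close> at both places (\<open>interleave_separated\<close>).
\<close>

section \<open>Fuzzy soft sets and the pointwise order\<close>

lemma FS_iff:
  "f \<in> FS X E \<longleftrightarrow>
    (\<forall>e x. 0 \<le> f e x \<and> f e x \<le> 1) \<and> (\<forall>e x. e \<notin> E \<or> x \<notin> X \<longrightarrow> f e x = 0)"
proof
  assume "f \<in> FS X E"
  then obtain A where A: "A \<subseteq> E" "\<And>e. e \<in> A \<Longrightarrow> f e \<in> fuzzy_sets X"
    "\<And>e. e \<notin> A \<Longrightarrow> f e = (\<lambda>x. 0)"
    unfolding FS_def is_fuzzy_soft_set_def by blast
  have "0 \<le> f e x \<and> f e x \<le> 1 \<and> (e \<notin> E \<or> x \<notin> X \<longrightarrow> f e x = 0)" for e x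
  proof (cases "e \<in> A")
    case True
    then show ?thesis using A(1) A(2)[OF True] unfolding fuzzy_sets_def by (cases "x \<in> X") auto
  next
    case False
    then show ?thesis using A(3) by simp
  qed
  then show "(\<forall>e x. 0 \<le> f e x \<and> f e x \<le> 1) \<and> (\<forall>e x. e \<notin> E \<or> x \<notin> X \<longrightarrow> f e x = 0)"
    by blast
next
  assume f: "(\<forall>e x. 0 \<le> f e x \<and> f e x \<le> 1) \<and> (\<forall>e x. e \<notin> E \<or> x \<notin> X \<longrightarrow> f e x = 0)"
  then have "is_fuzzy_soft_set X E {e. f e \<noteq> (\<lambda>x. 0)} f"
    unfolding is_fuzzy_soft_set_def fuzzy_sets_def by fastforce
  then show "f \<in> FS X E" unfolding FS_def by blast
qed

lemma FS_bounds: "f \<in> FS X E \<Longrightarrow> 0 \<le> f e x" "f \<in> FS X E \<Longrightarrow> f e x \<le> 1"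
  by (simp_all add: FS_iff)

lemma fs_one_in_FS: "fs_one X E \<in> FS X E"
  by (simp add: FS_iff fs_one_def)

lemma le_fs_one: "f \<in> FS X E \<Longrightarrow> f \<le> fs_one X E"
  by (simp add: FS_iff fs_one_def le_fun_def)

lemma fs_compl_in_FS: "f \<in> FS X E \<Longrightarrow> fs_compl X E f \<in> FS X E"
  by (simp add: FS_iff fs_compl_def)

lemma fs_compl_fs_compl: "f \<in> FS X E \<Longrightarrow> fs_compl X E (fs_compl X E f) = f"
  by (auto simp: FS_iff fs_compl_def fun_eq_iff)

lemma fs_point_in_FS: "e \<in> E \<Longrightarrow> x \<in> X \<Longrightarrow> 0 < \<alpha> \<Longrightarrow> \<alpha> \<le> 1 \<Longrightarrow> fs_point e x \<alpha> \<in> FS X E"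
  by (auto simp: FS_iff fs_point_def)

lemma fs_point_le_iff: "f \<in> FS X E \<Longrightarrow> fs_point e x \<alpha> \<le> f \<longleftrightarrow> \<alpha> \<le> f e x"
  by (auto simp: FS_iff fs_point_def le_fun_def)

lemma quasi_coincident_fs_point_iff:
  "f \<in> FS X E \<Longrightarrow> e \<in> E \<Longrightarrow> x \<in> X \<Longrightarrow> quasi_coincident X E (fs_point e x \<alpha>) f \<longleftrightarrow> 1 < \<alpha> + f e x"
  unfolding quasi_coincident_def fs_point_def using FS_bounds(2)[of f X E]
  by (auto simp: not_less[symmetric] split: if_splits)

lemma not_quasi_coincident_iff_le_compl:
  "f \<in> FS X E \<Longrightarrow> \<not> quasi_coincident X E f g \<longleftrightarrow> f \<le> fs_compl X E g"
  unfolding quasi_coincident_def fs_compl_def le_fun_def FS_iff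
  by (smt (verit))

lemma quasi_coincident_commute: "quasi_coincident X E f g \<longleftrightarrow> quasi_coincident X E g f"
  unfolding quasi_coincident_def by (simp add: add.commute)

lemma not_quasi_coincident_mono:
  "\<not> quasi_coincident X E f g \<Longrightarrow> f' \<le> f \<Longrightarrow> g' \<le> g \<Longrightarrow> \<not> quasi_coincident X E f' g'"
  unfolding quasi_coincident_def le_fun_def by (smt (verit))

text \<open>
  The order on \<open>real\<close> is only conditionally complete, so the usual rules for meets and joins
  hold for families of fuzzy soft sets because these take their values in \<open>[0, 1]\<close>.
\<close>

lemma Inf_family_apply: "Inf F e x = (INF f\<in>F. f e x)" for F :: "('e \<Rightarrow> 'x \<Rightarrow> real) set"
  by (simp add: Inf_fun_def image_image)

lemma Sup_family_apply: "Sup F e x = (SUP f\<in>F. f e x)" for F :: "('e \<Rightarrow> 'x \<Rightarrow> real) set"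
  by (simp add: Sup_fun_def image_image)

lemma bdd_below_FS: "F \<subseteq> FS X E \<Longrightarrow> bdd_below ((\<lambda>f. f e x) ` F)"
  by (rule bdd_belowI2[where m = 0]) (auto intro: FS_bounds(1))

lemma bdd_above_FS: "F \<subseteq> FS X E \<Longrightarrow> bdd_above ((\<lambda>f. f e x) ` F)"
  by (rule bdd_aboveI2[where M = 1]) (auto intro: FS_bounds(2))

lemma Inf_family_lower: "F \<subseteq> FS X E \<Longrightarrow> f \<in> F \<Longrightarrow> Inf F \<le> f"
  unfolding le_fun_def Inf_family_apply by (auto intro!: cINF_lower bdd_below_FS)

lemma Inf_family_greatest:
  "F \<noteq> {} \<Longrightarrow> (\<And>f. f \<in> F \<Longrightarrow> p \<le> f) \<Longrightarrow> p \<le> Inf F" for F :: "('e \<Rightarrow> 'x \<Rightarrow> real) set"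
  unfolding le_fun_def Inf_family_apply by (auto intro!: cINF_greatest)

lemma Sup_family_upper: "F \<subseteq> FS X E \<Longrightarrow> f \<in> F \<Longrightarrow> f \<le> Sup F"
  unfolding le_fun_def Sup_family_apply by (auto intro!: cSUP_upper bdd_above_FS)

lemma Sup_family_least:
  "F \<noteq> {} \<Longrightarrow> (\<And>f. f \<in> F \<Longrightarrow> f \<le> p) \<Longrightarrow> Sup F \<le> p" for F :: "('e \<Rightarrow> 'x \<Rightarrow> real) set"
  unfolding le_fun_def Sup_family_apply by (auto intro!: cSUP_least)

lemma Inf_family_in_FS:
  assumes "F \<subseteq> FS X E" "F \<noteq> {}"
  shows "Inf F \<in> FS X E"
proof -
  obtain f where f: "f \<in> F" using assms(2) by blast
  have "0 \<le> Inf F e x" for e x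
    using Inf_family_greatest[OF assms(2), of "\<lambda>e x. 0"] FS_bounds(1) assms(1)
    by (force simp: le_fun_def)
  moreover have "Inf F e x \<le> f e x" for e x
    using Inf_family_lower[OF assms(1) f] by (simp add: le_fun_def)
  ultimately show ?thesis
    using f assms(1) unfolding FS_iff subset_iff by (metis order_trans order_antisym)
qed

lemma fs_compl_antimono: "f \<le> g \<Longrightarrow> fs_compl X E g \<le> fs_compl X E f"
  by (simp add: fs_compl_def le_fun_def)

lemma fs_compl_Inf:
  assumes "F \<subseteq> FS X E" "F \<noteq> {}"
  shows "fs_compl X E (Inf F) = Sup (fs_compl X E ` F)"
proof (rule antisym)
  have sub: "fs_compl X E ` F \<subseteq> FS X E" and ne: "fs_compl X E ` F \<noteq> {}"
    using assms fs_compl_in_FS by auto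
  let ?S = "Sup (fs_compl X E ` F)"
  show "?S \<le> fs_compl X E (Inf F)"
    using ne assms by (intro Sup_family_least) (auto intro!: fs_compl_antimono Inf_family_lower)
  have S: "fs_compl X E f \<le> ?S" if "f \<in> F" for f
    using Sup_family_upper[OF sub] that by blast
  have le: "fs_compl X E ?S \<le> Inf F"
  proof (rule Inf_family_greatest[OF assms(2)])
    fix f assume "f \<in> F"
    then show "fs_compl X E ?S \<le> f"
      using fs_compl_antimono[OF S, of f X E] fs_compl_fs_compl[of f X E] assms(1) by auto
  qed
  have "0 \<le> ?S e x" for e x
  proof -
    obtain f where "f \<in> F" using assms(2) by blast
    with S[OF this] show ?thesis
      using fs_compl_in_FS[THEN FS_bounds(1), of f X E e x] assms(1)
      by (auto simp: le_fun_def intro: order_trans)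
  qed
  with le show "fs_compl X E (Inf F) \<le> ?S"
    by (auto simp: fs_compl_def le_fun_def split: if_splits) (smt (verit))
qed

section \<open>Closure and neighbourhoods\<close>

context
  fixes X :: "'x set" and E :: "'e set" and \<tau> :: "('e \<Rightarrow> 'x \<Rightarrow> real) set"
  assumes top: "fuzzy_soft_topology X E \<tau>"
begin

lemma open_in_FS: "f \<in> \<tau> \<Longrightarrow> f \<in> FS X E"
  and open_zero: "fs_zero \<in> \<tau>"
  and open_one: "fs_one X E \<in> \<tau>"
  and open_inf: "f \<in> \<tau> \<Longrightarrow> g \<in> \<tau> \<Longrightarrow> inf f g \<in> \<tau>"
  and open_Sup: "F \<subseteq> \<tau> \<Longrightarrow> F \<noteq> {} \<Longrightarrow> Sup F \<in> \<tau>"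
  using top unfolding fuzzy_soft_topology_def by blast+

lemma closed_Inf:
  assumes "\<And>f. f \<in> F \<Longrightarrow> fs_closed X E \<tau> f" "F \<noteq> {}"
  shows "fs_closed X E \<tau> (Inf F)"
proof -
  have "F \<subseteq> FS X E" "fs_compl X E ` F \<subseteq> \<tau>"
    using assms(1) unfolding fs_closed_def by auto
  then show ?thesis
    using assms(2) open_Sup[of "fs_compl X E ` F"] unfolding fs_closed_def
    by (simp add: Inf_family_in_FS fs_compl_Inf)
qed

lemma closed_one: "fs_closed X E \<tau> (fs_one X E)"
proof -
  have "fs_compl X E (fs_one X E) = fs_zero"
    by (auto simp: fs_compl_def fs_one_def fs_zero_def fun_eq_iff)
  then show ?thesis using open_zero fs_one_in_FS unfolding fs_closed_def by simp
qed

lemma closed_compl: "g \<in> \<tau> \<Longrightarrow> fs_closed X E \<tau> (fs_compl X E g)"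
  using open_in_FS fs_compl_in_FS fs_compl_fs_compl unfolding fs_closed_def by metis

text \<open>The least closed superset exists because the meet of all closed supersets is closed.\<close>

lemma
  assumes "f \<in> FS X E"
  shows closed_closure: "fs_closed X E \<tau> (fs_closure X E \<tau> f)"
    and closure_upper: "f \<le> fs_closure X E \<tau> f"
    and closure_least: "fs_closed X E \<tau> g \<Longrightarrow> f \<le> g \<Longrightarrow> fs_closure X E \<tau> f \<le> g"
proof -
  let ?C = "{g. fs_closed X E \<tau> g \<and> f \<le> g}"
  have sub: "?C \<subseteq> FS X E" unfolding fs_closed_def by blast
  have ne: "?C \<noteq> {}" using closed_one le_fs_one[OF assms] by blast
  have cl: "fs_closed X E \<tau> (Inf ?C)" using closed_Inf[of ?C] ne by blast
  have up: "f \<le> Inf ?C" using ne by (intro Inf_family_greatest) auto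
  have least: "Inf ?C \<le> g" if "fs_closed X E \<tau> g \<and> f \<le> g" for g
    using Inf_family_lower[OF sub, of g] that by blast
  have "fs_closure X E \<tau> f = Inf ?C"
    unfolding fs_closure_def using cl up least by (intro Least_equality) blast+
  then show "fs_closed X E \<tau> (fs_closure X E \<tau> f)" "f \<le> fs_closure X E \<tau> f"
    "fs_closed X E \<tau> g \<Longrightarrow> f \<le> g \<Longrightarrow> fs_closure X E \<tau> f \<le> g"
    using cl up least by auto
qed

lemma open_in_nbhds: "f \<in> \<tau> \<Longrightarrow> p \<le> f \<Longrightarrow> f \<in> fs_nbhds X E \<tau> p"
  unfolding fs_nbhds_def using open_in_FS by blast

lemma open_in_nbhds_iff: "f \<in> \<tau> \<Longrightarrow> f \<in> fs_nbhds X E \<tau> p \<longleftrightarrow> p \<le> f"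
  using open_in_nbhds unfolding fs_nbhds_def by (auto intro: order_trans)

lemma open_in_Q_nbhds: "g \<in> \<tau> \<Longrightarrow> quasi_coincident X E p g \<Longrightarrow> g \<in> fs_Q_nbhds X E \<tau> p"
  unfolding fs_Q_nbhds_def using open_in_FS by blast

abbreviation (input) nbhd_closures :: "('e \<Rightarrow> 'x \<Rightarrow> real) \<Rightarrow> ('e \<Rightarrow> 'x \<Rightarrow> real) set" where
  "nbhd_closures p \<equiv> {fs_closure X E \<tau> f | f. f \<in> fs_nbhds X E \<tau> p}"

lemma nbhd_closures_in_FS: "nbhd_closures p \<subseteq> FS X E"
  using closed_closure unfolding fs_nbhds_def fs_closed_def by blast

lemma nbhd_closures_nonempty: "p \<in> FS X E \<Longrightarrow> nbhd_closures p \<noteq> {}"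
  using open_in_nbhds[OF open_one le_fs_one] by blast

lemma le_Inf_closures:
  assumes "p \<in> FS X E"
  shows "p \<le> Inf (nbhd_closures p)"
proof (rule Inf_family_greatest[OF nbhd_closures_nonempty[OF assms]])
  fix k assume "k \<in> nbhd_closures p"
  then obtain f where k: "k = fs_closure X E \<tau> f" and f: "f \<in> FS X E" "p \<le> f"
    unfolding fs_nbhds_def by (auto intro: order_trans)
  show "p \<le> k" using closure_upper[OF f(1)] f(2) unfolding k by (rule order_trans[rotated])
qed

text \<open>
  The complement of a closed set above \<open>f\<close> is an open set that is not quasi-coincident with \<open>f\<close>,
  and conversely.  A value of the closure below \<open>c\<close> is a value of the open set above \<open>1 - c\<close>.
\<close>

lemma Inf_closures_less_iff:
  assumes p: "p \<in> FS X E" and "e \<in> E" "y \<in> X"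
  shows "Inf (nbhd_closures p) e y < c \<longleftrightarrow>
    (\<exists>f\<in>\<tau>. \<exists>g\<in>\<tau>. p \<le> f \<and> \<not> quasi_coincident X E f g \<and> 1 - c < g e y)"
proof
  assume "Inf (nbhd_closures p) e y < c"
  then obtain k where "k \<in> nbhd_closures p" and less: "k e y < c"
    unfolding Inf_family_apply
    using cInf_lessD[of "(\<lambda>f. f e y) ` nbhd_closures p"] nbhd_closures_nonempty[OF p]
    by blast
  then obtain f h where k: "k = fs_closure X E \<tau> f" and f: "f \<in> FS X E"
    and h: "h \<in> \<tau>" "p \<le> h" "h \<le> f"
    unfolding fs_nbhds_def by blast
  let ?g = "fs_compl X E k"
  have "k \<in> FS X E" and g: "?g \<in> \<tau>" using closed_closure[OF f] unfolding k fs_closed_def by auto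
  then have "h \<le> fs_compl X E ?g"
    using order_trans[OF h(3) closure_upper[OF f]] unfolding k by (simp add: fs_compl_fs_compl)
  then have "\<not> quasi_coincident X E h ?g"
    using not_quasi_coincident_iff_le_compl[OF open_in_FS[OF h(1)]] by blast
  moreover have "1 - c < ?g e y" using assms less by (simp add: fs_compl_def)
  ultimately show "\<exists>f\<in>\<tau>. \<exists>g\<in>\<tau>. p \<le> f \<and> \<not> quasi_coincident X E f g \<and> 1 - c < g e y"
    using h g by blast
next
  assume "\<exists>f\<in>\<tau>. \<exists>g\<in>\<tau>. p \<le> f \<and> \<not> quasi_coincident X E f g \<and> 1 - c < g e y"
  then obtain f g where f: "f \<in> \<tau>" "p \<le> f" and g: "g \<in> \<tau>" "1 - c < g e y"
    and nq: "\<not> quasi_coincident X E f g" by blast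
  have "f \<le> fs_compl X E g"
    using nq not_quasi_coincident_iff_le_compl[OF open_in_FS[OF f(1)]] by blast
  then have "fs_closure X E \<tau> f \<le> fs_compl X E g"
    using closure_least[OF open_in_FS[OF f(1)] closed_compl[OF g(1)]] by blast
  moreover have "Inf (nbhd_closures p) \<le> fs_closure X E \<tau> f"
    using open_in_nbhds[OF f] by (intro Inf_family_lower[OF nbhd_closures_in_FS]) blast
  ultimately have "Inf (nbhd_closures p) \<le> fs_compl X E g" by (rule order_trans[rotated])
  then have "Inf (nbhd_closures p) e y \<le> fs_compl X E g e y" by (rule le_funD[OF le_funD])
  then show "Inf (nbhd_closures p) e y < c" using assms g by (simp add: fs_compl_def)
qed

section \<open>Separating two places at full level\<close>

primrec initial_meet :: "(nat \<Rightarrow> 'e \<Rightarrow> 'x \<Rightarrow> real) \<Rightarrow> nat \<Rightarrow> 'e \<Rightarrow> 'x \<Rightarrow> real" where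
  "initial_meet f 0 = f 0"
| "initial_meet f (Suc k) = inf (initial_meet f k) (f (Suc k))"

lemma initial_meet_open: "(\<And>k. f k \<in> \<tau>) \<Longrightarrow> initial_meet f k \<in> \<tau>"
  by (induction k) (auto intro: open_inf)

lemma initial_meet_le: "j \<le> k \<Longrightarrow> initial_meet f k \<le> f j"
  by (induction k) (auto simp: le_Suc_eq intro: le_infI1)

lemma initial_meet_ge: "(\<And>k. c \<le> f k e x) \<Longrightarrow> c \<le> initial_meet f k e x"
  by (induction k) auto

lemma Sup_open_ge_one:
  assumes "\<And>k. f k \<in> \<tau>" and "\<And>k::nat. 1 - 1 / real (Suc k) \<le> f k e x"
  shows "1 \<le> Sup (range f) e x"
proof (rule field_le_epsilon)
  fix \<epsilon> :: real assume "0 < \<epsilon>"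
  then obtain k where k: "1 / real (Suc k) < \<epsilon>" using nat_approx_posE by metis
  have "range f \<subseteq> FS X E" using assms(1) open_in_FS by blast
  then have "f k e x \<le> Sup (range f) e x"
    using Sup_family_upper[of "range f" X E "f k"] by (simp add: le_fun_def)
  then show "1 \<le> Sup (range f) e x + \<epsilon>" using assms(2)[of k] k by linarith
qed

text \<open>
  The approaching sets \<open>f' k\<close> and \<open>g k\<close> are joined to
  reach level \<open>1\<close> in the limit, each first cut down by the initial meet of the sets that reach
  it, which costs nothing at the place in question.  The \<open>j\<close>-th piece of \<open>u\<close> and the \<open>k\<close>-th piece of \<open>v\<close>
  stay separated: if \<open>k \<le> j\<close> they lie below \<open>f k\<close> and \<open>g k\<close>, otherwise below \<open>f' j\<close> and \<open>g' j\<close>.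
\<close>

lemma interleave_separated:
  assumes "\<And>k. f k \<in> \<tau>" "\<And>k. g k \<in> \<tau>" "\<And>k. f' k \<in> \<tau>" "\<And>k. g' k \<in> \<tau>"
    and sep: "\<And>k. \<not> quasi_coincident X E (f k) (g k)" "\<And>k. \<not> quasi_coincident X E (f' k) (g' k)"
    and reach: "\<And>k. 1 \<le> f k e x" "\<And>k. 1 \<le> g' k d y"
    and approach: "\<And>k::nat. 1 - 1 / real (Suc k) \<le> f' k e x"
      "\<And>k::nat. 1 - 1 / real (Suc k) \<le> g k d y"
  shows "\<exists>u\<in>\<tau>. \<exists>v\<in>\<tau>. 1 \<le> u e x \<and> 1 \<le> v d y \<and> \<not> quasi_coincident X E u v"
proof -
  define a where "a k = inf (f' k) (initial_meet f k)" for k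
  define b where "b k = inf (g k) (initial_meet g' k)" for k
  have op: "a k \<in> \<tau>" "b k \<in> \<tau>" for k
    unfolding a_def b_def using assms(1-4) by (simp_all add: open_inf initial_meet_open)
  have mem: "Sup (range a) \<in> \<tau>" "Sup (range b) \<in> \<tau>" using op by (auto intro!: open_Sup)
  have small: "1 - 1 / real (Suc k) \<le> 1" for k by simp
  have u: "1 \<le> Sup (range a) e x"
  proof (rule Sup_open_ge_one[OF op(1)])
    show "1 - 1 / real (Suc k) \<le> a k e x" for k
      unfolding a_def using approach(1)[of k] order_trans[OF small initial_meet_ge[of 1 f, OF reach(1)]]
      by simp
  qed
  have v: "1 \<le> Sup (range b) d y"
  proof (rule Sup_open_ge_one[OF op(2)])
    show "1 - 1 / real (Suc k) \<le> b k d y" for k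
      unfolding b_def using approach(2)[of k] order_trans[OF small initial_meet_ge[of 1 g', OF reach(2)]]
      by simp
  qed
  have ab: "\<not> quasi_coincident X E (a j) (b k)" for j k
  proof (cases "k \<le> j")
    case True
    then have "a j \<le> f k" "b k \<le> g k"
      unfolding a_def b_def using initial_meet_le[of k j f] by (auto intro: le_infI2)
    then show ?thesis using not_quasi_coincident_mono sep(1) by blast
  next
    case False
    then have "a j \<le> f' j" "b k \<le> g' j"
      unfolding a_def b_def using initial_meet_le[of j k g'] by (auto intro: le_infI2)
    then show ?thesis using not_quasi_coincident_mono sep(2) by blast
  qed
  have "Sup (range a) e' x' + Sup (range b) e' x' \<le> 1" if "e' \<in> E" "x' \<in> X" for e' x'
  proof -
    have le: "a j e' x' \<le> 1 - b k e' x'" for j k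
      using ab[of j k] that unfolding quasi_coincident_def by force
    have "Sup (range a) e' x' \<le> 1 - b k e' x'" for k
      unfolding Sup_family_apply using le by (intro cSUP_least) auto
    then have "b k e' x' \<le> 1 - Sup (range a) e' x'" for k by (simp add: le_diff_eq add.commute)
    then have "Sup (range b) e' x' \<le> 1 - Sup (range a) e' x'"
      unfolding Sup_family_apply[of "range b"] by (intro cSUP_least) auto
    then show ?thesis by simp
  qed
  then have "\<not> quasi_coincident X E (Sup (range a)) (Sup (range b))"
    unfolding quasi_coincident_def by force
  with mem u v show ?thesis by blast
qed

lemma separated_at_full_level:
  assumes "e \<in> E" "x \<in> X" "d \<in> E" "y \<in> X"
    and ex: "Inf (nbhd_closures (fs_point e x 1)) d y \<le> 0"
    and dy: "Inf (nbhd_closures (fs_point d y 1)) e x \<le> 0"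
  shows "\<exists>u\<in>\<tau>. \<exists>v\<in>\<tau>. 1 \<le> u e x \<and> 1 \<le> v d y \<and> \<not> quasi_coincident X E u v"
proof -
  have near: "\<exists>f\<in>\<tau>. \<exists>g\<in>\<tau>. 1 \<le> f e x \<and> \<not> quasi_coincident X E f g \<and> 1 - 1 / real (Suc k) \<le> g d y"
    if at: "e \<in> E" "x \<in> X" "d \<in> E" "y \<in> X"
      and zero: "Inf (nbhd_closures (fs_point e x 1)) d y \<le> 0" for e x d y k
  proof -
    have p: "fs_point e x 1 \<in> FS X E" using at by (simp add: fs_point_in_FS)
    have "Inf (nbhd_closures (fs_point e x 1)) d y < 1 / real (Suc k)"
      using zero by (rule order_le_less_trans) simp
    then obtain f g where "f \<in> \<tau>" "g \<in> \<tau>" "fs_point e x 1 \<le> f" "\<not> quasi_coincident X E f g"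
      "1 - 1 / real (Suc k) < g d y"
      using Inf_closures_less_iff[OF p at(3,4)] by blast
    then show ?thesis using fs_point_le_iff[OF open_in_FS] by (meson less_imp_le)
  qed
  obtain f g where fg: "\<And>k. f k \<in> \<tau>" "\<And>k. g k \<in> \<tau>" "\<And>k. 1 \<le> f k e x"
    "\<And>k. \<not> quasi_coincident X E (f k) (g k)" "\<And>k. 1 - 1 / real (Suc k) \<le> g k d y"
    using near[OF assms(1-4) ex] by metis
  obtain g' f' where fg': "\<And>k. g' k \<in> \<tau>" "\<And>k. f' k \<in> \<tau>" "\<And>k. 1 \<le> g' k d y"
    "\<And>k. \<not> quasi_coincident X E (g' k) (f' k)" "\<And>k. 1 - 1 / real (Suc k) \<le> f' k e x"
    using near[OF assms(3,4,1,2) dy] by metis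
  show ?thesis
    using interleave_separated[of f g f' g' e x d y] fg fg' quasi_coincident_commute by metis
qed

section \<open>The T2 property and the meet of neighbourhood closures\<close>

lemma Inf_closures_eq_point:
  assumes T2: "fs_q_T2 X E \<tau>" and p: "e \<in> E" "x \<in> X" "0 < \<alpha>" "\<alpha> \<le> 1"
  shows "Inf (nbhd_closures (fs_point e x \<alpha>)) = fs_point e x \<alpha>" (is "Inf (nbhd_closures ?p) = _")
proof (rule antisym)
  have pFS: "?p \<in> FS X E" using p by (rule fs_point_in_FS)
  show "?p \<le> Inf (nbhd_closures ?p)" using pFS by (rule le_Inf_closures)
  have I: "Inf (nbhd_closures ?p) \<in> FS X E"
    using nbhd_closures_in_FS nbhd_closures_nonempty[OF pFS] by (rule Inf_family_in_FS)
  have "Inf (nbhd_closures ?p) d y \<le> ?p d y" for d y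
  proof (cases "d \<in> E \<and> y \<in> X")
    case False
    then show ?thesis using I pFS unfolding FS_iff by auto
  next
    case True
    show ?thesis
    proof (rule dense_ge)
      fix c assume c: "?p d y < c"
      have "\<exists>f\<in>\<tau>. \<exists>g\<in>\<tau>. ?p \<le> f \<and> \<not> quasi_coincident X E f g \<and> 1 - c < g d y"
      proof (cases "d = e \<and> y = x")
        case False
        then have ne: "e \<noteq> d \<or> x \<noteq> y" and "0 < c" using c by (auto simp: fs_point_def)
        have "?p \<noteq> fs_point d y 1" using ne p by (auto simp: fs_point_def fun_eq_iff)
        then obtain f g where "f \<in> \<tau>" "g \<in> \<tau>" "?p \<le> f" "fs_point d y 1 \<le> g"
          "\<not> quasi_coincident X E f g"
          using T2 True ne p open_in_nbhds_iff unfolding fs_q_T2_def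
          by (metis greaterThanAtMost_iff order_refl zero_less_one)
        then show ?thesis
          using \<open>0 < c\<close> fs_point_le_iff[OF open_in_FS, of g d y 1]
          by (intro bexI[of _ f] bexI[of _ g]) auto
      next
        case same: True
        then have "\<alpha> < c" using c by (simp add: fs_point_def)
        show ?thesis
        proof (cases "c \<le> 1")
          case True
          have "?p \<noteq> fs_point e x c" using \<open>\<alpha> < c\<close> by (auto simp: fs_point_def fun_eq_iff)
          moreover have "c \<in> {0<..1}" "\<alpha> \<in> {0<..1}" using \<open>\<alpha> < c\<close> True p by auto
          ultimately obtain f g where fg: "f \<in> \<tau>" "?p \<le> f" "g \<in> fs_Q_nbhds X E \<tau> (fs_point e x c)"
            "\<not> quasi_coincident X E f g"
            using T2 p \<open>\<alpha> < c\<close> open_in_nbhds_iff unfolding fs_q_T2_def by metis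
          then obtain h where h: "h \<in> \<tau>" "quasi_coincident X E (fs_point e x c) h" "h \<le> g"
            unfolding fs_Q_nbhds_def by blast
          have "1 < c + h e x"
            using quasi_coincident_fs_point_iff[OF open_in_FS[OF h(1)] p(1,2)] h(2) by blast
          then have "1 - c < h d y" using same by simp
          moreover have "\<not> quasi_coincident X E f h"
            using fg(4) h(3) not_quasi_coincident_mono by blast
          ultimately show ?thesis using fg h by blast
        next
          case False
          \<comment> \<open>No point has a level \<open>c > 1\<close>, but there the bound is trivial: the whole space and the
            empty set are separated.\<close>
          then show ?thesis
            using open_one open_zero le_fs_one[OF pFS]
            by (intro bexI[of _ "fs_one X E"] bexI[of _ fs_zero])
              (auto simp: fs_zero_def quasi_coincident_def fs_one_def)
        qed
      qed
      then show "Inf (nbhd_closures ?p) d y \<le> c"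
        using Inf_closures_less_iff[OF pFS, of d y c] True by simp
    qed
  qed
  then show "Inf (nbhd_closures ?p) \<le> ?p" by (simp add: le_fun_def)
qed

lemma q_T2_if_Inf_closures_eq_point:
  assumes eq: "\<And>e x \<alpha>. e \<in> E \<Longrightarrow> x \<in> X \<Longrightarrow> \<alpha> \<in> {0<..1} \<Longrightarrow>
    Inf (nbhd_closures (fs_point e x \<alpha>)) = fs_point e x \<alpha>"
  shows "fs_q_T2 X E \<tau>"
  unfolding fs_q_T2_def
proof (intro ballI impI conjI)
  fix e d x y and \<alpha> \<beta> :: real
  assume mem: "e \<in> E" "d \<in> E" "x \<in> X" "y \<in> X" "\<alpha> \<in> {0<..1}" "\<beta> \<in> {0<..1}"
  show "\<exists>f\<in>\<tau>. \<exists>g\<in>\<tau>. f \<in> fs_nbhds X E \<tau> (fs_point e x \<alpha>) \<and>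
      g \<in> fs_nbhds X E \<tau> (fs_point d y \<beta>) \<and> \<not> quasi_coincident X E f g"
    if "e \<noteq> d \<or> x \<noteq> y"
  proof -
    \<comment> \<open>A neighbourhood of the point of level \<open>1\<close> is one of every lower point at the same place,
      so it is enough to separate the two places at full level.\<close>
    have one: "(1::real) \<in> {0<..1}" by simp
    have "fs_point e x 1 d y = 0" "fs_point d y 1 e x = 0"
      using that by (auto simp: fs_point_def)
    then have "Inf (nbhd_closures (fs_point e x 1)) d y \<le> 0"
      "Inf (nbhd_closures (fs_point d y 1)) e x \<le> 0"
      unfolding eq[OF mem(1,3) one] eq[OF mem(2,4) one] by simp_all
    then obtain u v where uv: "u \<in> \<tau>" "v \<in> \<tau>" "1 \<le> u e x" "1 \<le> v d y"
      "\<not> quasi_coincident X E u v"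
      using separated_at_full_level mem by blast
    then have "fs_point e x \<alpha> \<le> u" "fs_point d y \<beta> \<le> v"
      using mem fs_point_le_iff[OF open_in_FS] by auto
    then show ?thesis
      using uv open_in_nbhds by blast
  qed
  show "\<exists>f\<in>\<tau>. \<exists>g\<in>\<tau>. f \<in> fs_nbhds X E \<tau> (fs_point e x \<alpha>) \<and>
      g \<in> fs_Q_nbhds X E \<tau> (fs_point d y \<beta>) \<and> \<not> quasi_coincident X E f g"
    if same: "e = d \<and> x = y \<and> \<alpha> < \<beta>"
  proof -
    have "fs_point e x \<alpha> \<in> FS X E" using mem by (simp add: fs_point_in_FS)
    moreover have "Inf (nbhd_closures (fs_point e x \<alpha>)) d y < \<beta>"
      unfolding eq[OF mem(1,3,5)] using same by (simp add: fs_point_def)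
    ultimately obtain f g where fg: "f \<in> \<tau>" "g \<in> \<tau>" "fs_point e x \<alpha> \<le> f"
      "\<not> quasi_coincident X E f g" "1 - \<beta> < g d y"
      using Inf_closures_less_iff[of "fs_point e x \<alpha>" d y \<beta>] mem by blast
    then have "quasi_coincident X E (fs_point d y \<beta>) g"
      using quasi_coincident_fs_point_iff[OF open_in_FS] mem by force
    then show ?thesis
      using fg open_in_nbhds open_in_Q_nbhds by blast
  qed
qed

end

theorem theorem11:
  fixes X :: "'x set" and E :: "'e set" and \<tau> :: "('e \<Rightarrow> 'x \<Rightarrow> real) set"
  assumes "X \<noteq> {}"
    and "fuzzy_soft_topology X E \<tau>"
  shows "fs_q_T2 X E \<tau> \<longleftrightarrow>
    (\<forall>e\<in>E. \<forall>x\<in>X. \<forall>\<alpha>\<in>{0<..1}.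
       fs_point e x \<alpha> = Inf {fs_closure X E \<tau> f | f. f \<in> fs_nbhds X E \<tau> (fs_point e x \<alpha>)})"
proof
  assume "fs_q_T2 X E \<tau>"
  then show "\<forall>e\<in>E. \<forall>x\<in>X. \<forall>\<alpha>\<in>{0<..1}.
      fs_point e x \<alpha> = Inf {fs_closure X E \<tau> f | f. f \<in> fs_nbhds X E \<tau> (fs_point e x \<alpha>)}"
    by (intro ballI Inf_closures_eq_point[OF assms(2), symmetric]) simp_all
next
  assume eq: "\<forall>e\<in>E. \<forall>x\<in>X. \<forall>\<alpha>\<in>{0<..1}.
      fs_point e x \<alpha> = Inf {fs_closure X E \<tau> f | f. f \<in> fs_nbhds X E \<tau> (fs_point e x \<alpha>)}"
  show "fs_q_T2 X E \<tau>"
    by (rule q_T2_if_Inf_closures_eq_point[OF assms(2)], rule eq[rule_format, symmetric])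
qed

end
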